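(* Let $f$ be the Gray Takagi function, $$f(x)=\sum_{n=0}^\infty\frac{r_n(x)}{2^n}\phi(2^n x),\qquad 0\le x\le 1,$$ where $r_n(x)=(-1)^{\lfloor 2^n x\rfloor}$. Then $$\dim_H L_f(0)=d_0:=\frac{\log\big((1+\sqrt5)/2\big)}{\log 4}.$$
   Context: $\phi(x)=\operatorname{dist}(x,\mathbb{Z})$ is the distance from $x\in\mathbb{R}$ to the nearest integer. $L_f(0)=\{x\in[0,1]: f(x)=0\}$. $\dim_H$ denotes Hausdorff dimension. *)

theory Defs
  imports "HOL-Analysis.Analysis"
begin

(* The convention 0^0 = 1 for nonempty sets makes the measure with s = 0 the counting measure;
   powr alone would give 0 powr 0 = 0. *)
definition diam_pow :: "real \<Rightarrow> 'a::metric_space set \<Rightarrow> real" where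
  "diam_pow s U = (if U = {} then 0 else if s = 0 then 1 else diameter U powr s)"

(* Boundedness is required explicitly because the real-valued diameter of an unbounded set
   is an unspecified number. The sets U i may be empty, so finite covers are included. *)
definition hausdorff_premeasure :: "real \<Rightarrow> real \<Rightarrow> 'a::metric_space set \<Rightarrow> ennreal" where
  "hausdorff_premeasure s \<delta> A =
     Inf {(\<Sum>i. ennreal (diam_pow s (U i))) | U :: nat \<Rightarrow> 'a set.
            A \<subseteq> (\<Union>i. U i) \<and> (\<forall>i. bounded (U i) \<and> diameter (U i) \<le> \<delta>)}"

definition hausdorff_measure :: "real \<Rightarrow> 'a::metric_space set \<Rightarrow> ennreal" where
  "hausdorff_measure s A = (SUP \<delta>\<in>{0<..}. hausdorff_premeasure s \<delta> A)"

definition hausdorff_dim :: "'a::metric_space set \<Rightarrow> ereal" where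
  "hausdorff_dim A = Inf {ereal s | s. 0 \<le> s \<and> hausdorff_measure s A = 0}"

definition dist_int :: "real \<Rightarrow> real" where
  "dist_int x = infdist x \<int>"

definition rademacher :: "nat \<Rightarrow> real \<Rightarrow> real" where
  "rademacher n x = (-1) powi \<lfloor>2 ^ n * x\<rfloor>"

definition gray_takagi :: "real \<Rightarrow> real" where
  "gray_takagi x = (\<Sum>n. rademacher n x / 2 ^ n * dist_int (2 ^ n * x))"

definition level_set :: "(real \<Rightarrow> real) \<Rightarrow> real \<Rightarrow> real set" where
  "level_set f y = {x \<in> {0..1}. f x = y}"

end

theory Submission
  imports Defs
begin

text \<open>Write \<open>f\<close> for the Gray Takagi function. Its summands are dilates of one triangle wave that is
  odd about 1, and this turns the doubling relation into two equations for \<open>u\<close> in \<open>[0, 1]\<close>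
  (\<open>gray_takagi_lower_half\<close>, \<open>gray_takagi_upper_half\<close>):
  \<open>f (u / 2) = u / 2 + f u / 2\<close> and \<open>f (1 - u / 2) = u / 2 - f u / 2\<close>.
  Thus the solutions of \<open>f u + m u + a = 0\<close> in either half of \<open>[0, 1]\<close> are an affine copy of
  the solutions of \<open>f u + (m + 1) u + 2 a = 0\<close> or of \<open>f u + (m - 1) u - 2 (m + a) = 0\<close>. When these
  substitutions are started at \<open>m = a = 0\<close>, the estimate \<open>f u \<ge> - u / 2\<close> (\<open>gray_takagi_ge\<close>)
  rules out all solutions on most branches, or all but the trivial one at 0. What survives is a
  finite cycle: apart from 0, the zero set is a copy of the set \<open>B\<close> of fixed points of \<open>f\<close>, and
  \<open>B = {0} \<union> (1/2 - B / 4) \<union> (1/2 + B / 16)\<close>.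

  The two contractions have ratios 1/4 and 1/16, so the dimension \<open>d\<close> is the solution of
  \<open>4 powr - d + 16 powr - d = 1\<close>, that is, \<open>p = 4 powr - d\<close> satisfies \<open>p + p\<^sup>2 = 1\<close> and \<open>1 / p\<close> is the
  golden ratio.

  For \<open>s > d\<close>, iterating the decomposition covers \<open>B\<close> by finitely many points and by intervals whose
  \<open>s\<close>-costs add up to a power of \<open>4 powr - s + 16 powr - s < 1\<close>
  (\<open>gray_takagi_fix_cover\<close>). The points have cost 0.

  For \<open>s \<le> d\<close>, split \<open>[0, 1]\<close> into pieces of lengths \<open>p\<close> and \<open>p\<^sup>2\<close> and repeat the subdivision.
  Sending each piece to the piece of \<open>B\<close> with the same address gives a map \<open>G\<close> from \<open>[0, 1]\<close> into \<open>B\<close>.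
  The two contractions separate the points of \<open>[1/4, 1]\<close> by a definite gap, hence
  \<open>\<bar>t - t'\<bar> \<le> C * \<bar>G t - G t'\<bar> powr d\<close> (\<open>coding_expanding\<close>). A cover of the zero set with small
  cost would therefore pull back to a cover of \<open>[0, 1]\<close> by intervals of small total length
  (\<open>hausdorff_measure_pos_if_expanding\<close>).\<close>

section \<open>Two functional equations\<close>

text \<open>Reflection at half an integer permutes the integers and preserves distances. The inequality
  suffices because the reflection is an involution.\<close>

lemma dist_int_reflect_le: "dist_int (of_int k - x) \<le> dist_int x"
  unfolding dist_int_def
proof (subst (2) infdist_notempty)
  show "(\<int>::real set) \<noteq> {}" using Ints_0 by blast
  show "infdist (of_int k - x) \<int> \<le> (INF a\<in>\<int>. dist x a)"
  proof (rule cINF_greatest)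
    fix z :: real assume "z \<in> \<int>"
    then have "infdist (of_int k - x) \<int> \<le> dist (of_int k - x) (of_int k - z)"
      by (intro infdist_le) auto
    also have "\<dots> = dist x z" by (simp add: dist_real_def)
    finally show "infdist (of_int k - x) \<int> \<le> dist x z" .
  qed (use Ints_0 in blast)
qed

lemma dist_int_reflect: "dist_int (of_int k - x) = dist_int x"
  using dist_int_reflect_le[of k x] dist_int_reflect_le[of k "of_int k - x"] by simp

lemma dist_int_Ints: "x \<in> \<int> \<Longrightarrow> dist_int x = 0"
  by (simp add: dist_int_def)

lemma dist_int_nonneg: "0 \<le> dist_int x"
  by (simp add: dist_int_def infdist_nonneg)

lemma dist_int_le_half: "dist_int x \<le> 1/2"
proof -
  have "dist_int x \<le> dist x (of_int (round x))"
    unfolding dist_int_def by (intro infdist_le) auto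
  also have "\<dots> \<le> 1/2"
    using of_int_round_abs_le[of x] by (simp add: dist_real_def abs_minus_commute)
  finally show ?thesis .
qed

lemma dist_int_lower_half:
  assumes "0 \<le> x" "x \<le> 1/2"
  shows "dist_int x = x"
proof (rule antisym)
  have "dist_int x \<le> dist x 0"
    unfolding dist_int_def by (intro infdist_le) auto
  then show "dist_int x \<le> x" using assms by simp
  show "x \<le> dist_int x"
    unfolding dist_int_def
  proof (subst infdist_notempty)
    show "(\<int>::real set) \<noteq> {}" using Ints_0 by blast
    show "x \<le> (INF a\<in>\<int>. dist x a)"
    proof (rule cINF_greatest)
      fix z :: real assume "z \<in> \<int>"
      then obtain k where z: "z = of_int k" by (auto elim: Ints_cases)
      have "k \<le> 0 \<or> 1 \<le> k" by linarith
      then have "z \<le> 0 \<or> 1 \<le> z" unfolding z by simp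
      then show "x \<le> dist x z" using assms by (auto simp: dist_real_def)
    qed (use Ints_0 in blast)
  qed
qed

lemma dist_int_upper_half:
  assumes "1/2 \<le> x" "x \<le> 1"
  shows "dist_int x = 1 - x"
  using dist_int_reflect[of 1 x] dist_int_lower_half[of "1 - x"] assms by simp

lemma minus_one_powi: "(-1::real) powi k = (if even k then 1 else -1)"
  by (cases "k \<ge> 0") (auto simp: power_int_def even_nat_iff)

lemma abs_rademacher [simp]: "\<bar>rademacher n x\<bar> = 1"
  by (simp add: rademacher_def minus_one_powi)

lemma gray_takagi_term_le:
  "\<bar>rademacher n x / 2 ^ n * dist_int (2 ^ n * x)\<bar> \<le> 1/2 * (1/2) ^ n"
  using dist_int_le_half[of "2 ^ n * x"] dist_int_nonneg[of "2 ^ n * x"]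
  by (simp add: abs_mult power_divide divide_simps)

lemma summable_gray_takagi:
  "summable (\<lambda>n. rademacher n x / 2 ^ n * dist_int (2 ^ n * x))"
  by (rule summable_comparison_test[where g = "\<lambda>n. 1/2 * (1/2) ^ n"])
     (use gray_takagi_term_le in \<open>auto intro!: summable_mult summable_geometric\<close>)

lemma abs_gray_takagi_le: "\<bar>gray_takagi x\<bar> \<le> 1"
proof -
  have "\<bar>gray_takagi x\<bar> \<le> (\<Sum>n. 1/2 * (1/2) ^ n)"
    unfolding gray_takagi_def real_norm_def[symmetric]
    by (rule norm_suminf_le)
       (use gray_takagi_term_le in \<open>auto intro!: summable_mult summable_geometric\<close>)
  also have "\<dots> = 1/2 * (\<Sum>n. (1/2) ^ n)"
    by (rule suminf_mult) (auto intro: summable_geometric)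
  also have "\<dots> = 1" by (simp add: suminf_geometric)
  finally show ?thesis .
qed

lemma gray_takagi_double:
  "gray_takagi x = rademacher 0 x * dist_int x + gray_takagi (2 * x) / 2"
proof -
  have s: "(\<lambda>n. rademacher (Suc n) x / 2 ^ Suc n * dist_int (2 ^ Suc n * x))
      = (\<lambda>n. (rademacher n (2 * x) / 2 ^ n * dist_int (2 ^ n * (2 * x))) / 2)"
    by (rule ext) (simp add: rademacher_def mult.assoc mult.left_commute)
  have "gray_takagi x = rademacher 0 x * dist_int x
      + (\<Sum>n. rademacher (Suc n) x / 2 ^ Suc n * dist_int (2 ^ Suc n * x))"
    unfolding gray_takagi_def using suminf_split_head[OF summable_gray_takagi[of x]]
    by simp
  also have "\<dots> = rademacher 0 x * dist_int x + gray_takagi (2 * x) / 2"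
    unfolding s gray_takagi_def using suminf_divide[OF summable_gray_takagi[of "2 * x"], of 2]
    by simp
  finally show ?thesis .
qed

text \<open>Each summand is a triangle wave of period dividing 2 that is odd about 1: reflection
  preserves the distance to the integers and flips the parity of the floor, except where the
  dilated argument is an integer and the distance vanishes.\<close>

lemma gray_takagi_antisym: "gray_takagi (2 - x) = - gray_takagi x"
proof -
  have "rademacher n (2 - x) / 2 ^ n * dist_int (2 ^ n * (2 - x))
      = - (rademacher n x / 2 ^ n * dist_int (2 ^ n * x))" for n
  proof -
    let ?y = "2 ^ n * x"
    have e: "2 ^ n * (2 - x) = of_int (2 * 2 ^ n) - ?y" by (simp add: algebra_simps)
    show ?thesis
    proof (cases "?y \<in> \<int>")
      case True
      then show ?thesis unfolding e dist_int_reflect by (simp add: dist_int_Ints)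
    next
      case False
      then have "\<lceil>?y\<rceil> = \<lfloor>?y\<rfloor> + 1" by (simp add: ceiling_altdef Ints_def) (metis rangeI)
      then have "\<lfloor>of_int (2 * 2 ^ n) - ?y\<rfloor> = 2 * 2 ^ n - 1 - \<lfloor>?y\<rfloor>"
        by linarith
      then have "rademacher n (2 - x) = - rademacher n x"
        unfolding rademacher_def e minus_one_powi by simp
      then show ?thesis unfolding e dist_int_reflect by simp
    qed
  qed
  then show ?thesis
    unfolding gray_takagi_def using suminf_minus[OF summable_gray_takagi[of x]] by simp
qed

lemma rademacher_0_eq_1: "0 \<le> x \<Longrightarrow> x < 1 \<Longrightarrow> rademacher 0 x = 1"
proof -
  assume "0 \<le> x" "x < 1"
  then have "\<lfloor>x\<rfloor> = 0" by (simp add: floor_eq_iff)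
  then show ?thesis by (simp add: rademacher_def)
qed

lemma gray_takagi_lower_half:
  assumes "0 \<le> u" "u \<le> 1"
  shows "gray_takagi (u / 2) = u / 2 + gray_takagi u / 2"
  using gray_takagi_double[of "u / 2"] assms
  by (simp add: rademacher_0_eq_1 dist_int_lower_half)

lemma gray_takagi_upper_half:
  assumes "0 \<le> u" "u \<le> 1"
  shows "gray_takagi (1 - u / 2) = u / 2 - gray_takagi u / 2"
proof -
  have "rademacher 0 (1 - u / 2) * dist_int (1 - u / 2) = u / 2"
    using assms by (cases "u = 0") (simp_all add: rademacher_0_eq_1 dist_int_upper_half)
  moreover have "gray_takagi (2 * (1 - u / 2)) = - gray_takagi u"
    using gray_takagi_antisym[of u] by (simp add: algebra_simps)
  ultimately show ?thesis using gray_takagi_double[of "1 - u / 2"] by simp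
qed

lemma unit_interval_halves [consumes 2]:
  fixes x :: real
  assumes "0 \<le> x" "x \<le> 1"
  obtains (lower) u where "0 \<le> u" "u \<le> 1" "x = u / 2"
    | (upper) u where "0 \<le> u" "u \<le> 1" "x = 1 - u / 2"
proof (cases "x \<le> 1/2")
  case True
  then show thesis using assms by (intro lower[of "2 * x"]) auto
next
  case False
  then show thesis using assms by (intro upper[of "2 - 2 * x"]) (auto simp: field_simps)
qed

text \<open>One step of the functional equations halves the failure of this bound on the lower half
  of the interval and leaves no failure on the upper half, because \<open>\<bar>f\<bar> \<le> 1\<close>. So the failure is
  at most every power of 1/2. This bound excludes all the branches
  that do not contribute to the zero set.\<close>

lemma gray_takagi_ge:
  assumes "0 \<le> u" "u \<le> 1"
  shows "- u / 2 \<le> gray_takagi u"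
proof -
  have "- u / 2 - (1/2) ^ k \<le> gray_takagi u" if "0 \<le> u" "u \<le> 1" for k and u :: real
    using that
  proof (induction k arbitrary: u)
    case 0
    then show ?case using abs_gray_takagi_le[of u] by simp
  next
    case (Suc k)
    from Suc.prems show ?case
    proof (cases rule: unit_interval_halves)
      case (lower v)
      then show ?thesis
        using Suc.IH[OF lower(1,2)] gray_takagi_lower_half[OF lower(1,2)]
        unfolding lower(3) power_Suc by linarith
    next
      case (upper v)
      have "gray_takagi v \<le> 1" using abs_gray_takagi_le[of v] by linarith
      then have "- u / 2 \<le> gray_takagi u"
        using upper(1) gray_takagi_upper_half[OF upper(1,2)] unfolding upper(3) by (simp add: field_simps)
      moreover have "0 \<le> (1/2::real) ^ Suc k" by simp
      ultimately show ?thesis by linarith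
    qed
  qed
  then have le: "- u / 2 - gray_takagi u \<le> (1/2) ^ k" for k
    using assms by (smt (verit))
  have "(\<lambda>k. (1/2::real) ^ k) \<longlonglongrightarrow> 0" by (rule LIMSEQ_power_zero) simp
  then have "- u / 2 - gray_takagi u \<le> 0"
    by (rule LIMSEQ_le_const) (use le in auto)
  then show ?thesis by simp
qed

section \<open>The zero set and the fixed points\<close>

definition gray_takagi_fix :: "real set" where
  "gray_takagi_fix = {u \<in> {0..1}. gray_takagi u = u}"

lemma zero_iff_fixed:
  assumes "0 \<le> u" "u \<le> 1"
  shows "gray_takagi (1 - u / 2) = 0 \<longleftrightarrow> gray_takagi u = u"
  using gray_takagi_upper_half[OF assms] by auto

text \<open>A zero in the lower half comes from some \<open>u\<close> with \<open>f u = - u\<close>, which forces \<open>u = 0\<close>.\<close>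

lemma level_set_zero_subset:
  "level_set gray_takagi 0 \<subseteq> {0} \<union> (\<lambda>u. 1 - u / 2) ` gray_takagi_fix"
proof
  fix x assume "x \<in> level_set gray_takagi 0"
  then have x: "0 \<le> x" "x \<le> 1" "gray_takagi x = 0" by (auto simp: level_set_def)
  from x(1,2) show "x \<in> {0} \<union> (\<lambda>u. 1 - u / 2) ` gray_takagi_fix"
  proof (cases rule: unit_interval_halves)
    case (lower u)
    have "x = 0"
      using x gray_takagi_lower_half[OF lower(1,2), folded lower(3)] gray_takagi_ge[OF lower(1,2)] lower(3)
      by linarith
    then show ?thesis by simp
  next
    case (upper u)
    then show ?thesis using x zero_iff_fixed[of u] by (auto simp: gray_takagi_fix_def)
  qed
qed

text \<open>A fixed point in the lower half is half a zero of \<open>f\<close>, and zeros are already described by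
  fixed points. A fixed point in the upper half comes from a solution of \<open>f z = 2 z - 2\<close>; following
  it back, each step has one admissible half, through \<open>f w = 3 w\<close> and \<open>f v = 2 v\<close>, until a fixed
  point reappears on the scale 1/16.\<close>

lemma gray_takagi_fix_subset:
  "gray_takagi_fix \<subseteq> {0} \<union> (\<lambda>u. 1/2 - u / 4) ` gray_takagi_fix \<union> (\<lambda>u. 1/2 + u / 16) ` gray_takagi_fix"
proof
  fix x assume "x \<in> gray_takagi_fix"
  then have x: "0 \<le> x" "x \<le> 1" "gray_takagi x = x" by (auto simp: gray_takagi_fix_def)
  from x(1,2) show "x \<in> {0} \<union> (\<lambda>u. 1/2 - u / 4) ` gray_takagi_fix \<union> (\<lambda>u. 1/2 + u / 16) ` gray_takagi_fix"
  proof (cases rule: unit_interval_halves)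
    case (lower v)
    have "gray_takagi v = 0"
      using x gray_takagi_lower_half[OF lower(1,2), folded lower(3)] lower(3) by simp
    then have "v \<in> level_set gray_takagi 0"
      using lower by (simp add: level_set_def)
    then have "v = 0 \<or> (\<exists>u\<in>gray_takagi_fix. v = 1 - u / 2)"
      using level_set_zero_subset by blast
    then show ?thesis
    proof
      assume "\<exists>u\<in>gray_takagi_fix. v = 1 - u / 2"
      then obtain u where "u \<in> gray_takagi_fix" "x = 1/2 - u / 4" using lower by auto
      then show ?thesis by blast
    qed (use lower in simp)
  next
    case (upper z)
    then have z: "gray_takagi z = 2 * z - 2" using x gray_takagi_upper_half[of z] by simp
    then have z45: "4/5 \<le> z" using gray_takagi_ge[of z] upper by simp
    \<comment> \<open>The bound on \<open>z\<close> leaves only the upper half.\<close>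
    define w where "w = 2 - 2 * z"
    have w: "0 \<le> w" "w \<le> 2/5" "z = 1 - w / 2" using z45 upper by (auto simp: w_def field_simps)
    have fw: "gray_takagi w = 3 * w"
      using gray_takagi_upper_half[of w] w z by simp
    \<comment> \<open>The bound \<open>w \<le> 2/5\<close> leaves only the lower half.\<close>
    define v where "v = 2 * w"
    have v: "0 \<le> v" "v \<le> 4/5" "w = v / 2" using w by (auto simp: v_def)
    have fv: "gray_takagi v = 2 * v"
      using gray_takagi_lower_half[of v, folded v(3)] v(1,2) fw v_def by simp
    have "v \<le> 1" using v by simp
    with v(1) show ?thesis
    proof (cases rule: unit_interval_halves)
      case (lower u)
      then have "gray_takagi u = u" using gray_takagi_lower_half[OF lower(1,2), folded lower(3)] fv lower(3) by simp
      moreover have "x = 1/2 + u / 16" using upper(3) w(3) v(3) lower(3) by (simp add: field_simps)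
      ultimately show ?thesis using lower by (auto simp: gray_takagi_fix_def)
    next
      case (upper u)
      then have "gray_takagi u = 3 * u - 4" using gray_takagi_upper_half[of u] fv by simp
      then have False using upper gray_takagi_ge[of u] by simp
      then show ?thesis ..
    qed
  qed
qed

text \<open>Both contractions multiply the defect \<open>f u - u\<close> by their linear coefficient. In particular
  they map fixed points to fixed points, and the defect tends to 0 along every sequence of
  applications of the contractions, so the points with an infinite address are fixed points.\<close>

lemma fixed_point_defect_quarter:
  assumes "0 \<le> u" "u \<le> 1"
  shows "gray_takagi (1/2 - u / 4) - (1/2 - u / 4) = - (gray_takagi u - u) / 4"
  using gray_takagi_upper_half[of u] gray_takagi_lower_half[of "1 - u / 2"] assms
  by (simp add: field_simps)

lemma fixed_point_defect_sixteenth: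
  assumes "0 \<le> u" "u \<le> 1"
  shows "gray_takagi (1/2 + u / 16) - (1/2 + u / 16) = (gray_takagi u - u) / 16"
  using gray_takagi_lower_half[of u] gray_takagi_lower_half[of "u / 2"] gray_takagi_upper_half[of "u / 4"]
    gray_takagi_upper_half[of "1 - u / 8"] assms
  by (simp add: field_simps)

section \<open>Upper bound\<close>

lemma diam_pow_interval:
  assumes "a \<le> b" "0 < s"
  shows "diam_pow s {a..b} = (b - a) powr s"
  using assms by (simp add: diam_pow_def diameter_closed_interval)

lemma hausdorff_premeasure_le_intervals:
  fixes Is :: "(real \<times> real) list"
  assumes "0 < s" "0 < \<delta>"
    and A: "A \<subseteq> (\<Union>(a, b)\<in>set Is. {a..b})"
    and small: "\<And>a b. (a, b) \<in> set Is \<Longrightarrow> a \<le> b \<and> b - a \<le> \<delta>"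
  shows "hausdorff_premeasure s \<delta> A \<le> ennreal (\<Sum>(a, b)\<leftarrow>Is. (b - a) powr s)"
proof -
  define U where "U i = (if i < length Is then {fst (Is ! i)..snd (Is ! i)} else {})" for i
  have Is: "fst (Is ! i) \<le> snd (Is ! i)" "snd (Is ! i) - fst (Is ! i) \<le> \<delta>" if "i < length Is" for i
    using small[of "fst (Is ! i)" "snd (Is ! i)"] that by (simp_all add: nth_mem)
  have cover: "A \<subseteq> (\<Union>i. U i)"
  proof
    fix x assume "x \<in> A"
    then obtain a b where ab: "(a, b) \<in> set Is" "x \<in> {a..b}" using A by blast
    then obtain i where "i < length Is" "Is ! i = (a, b)" by (auto simp: in_set_conv_nth)
    with ab have "x \<in> U i" by (simp add: U_def)
    then show "x \<in> (\<Union>i. U i)" by blast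
  qed
  have mesh: "bounded (U i) \<and> diameter (U i) \<le> \<delta>" for i
    using Is[of i] assms by (auto simp: U_def diameter_closed_interval)
  have "hausdorff_premeasure s \<delta> A \<le> (\<Sum>i. ennreal (diam_pow s (U i)))"
    unfolding hausdorff_premeasure_def by (rule Inf_lower) (use cover mesh in auto)
  also have "\<dots> = (\<Sum>i<length Is. ennreal (diam_pow s (U i)))"
    by (rule suminf_finite) (auto simp: U_def diam_pow_def)
  also have "\<dots> = (\<Sum>i<length Is. ennreal ((\<lambda>(a, b). (b - a) powr s) (Is ! i)))"
    using Is assms(1) by (intro sum.cong) (auto simp: U_def diam_pow_interval case_prod_beta)
  also have "\<dots> = ennreal (\<Sum>i<length Is. (\<lambda>(a, b). (b - a) powr s) (Is ! i))"
    by (rule sum_ennreal) (auto simp: case_prod_beta)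
  also have "(\<Sum>i<length Is. (\<lambda>(a, b). (b - a) powr s) (Is ! i)) = (\<Sum>(a, b)\<leftarrow>Is. (b - a) powr s)"
    by (simp add: sum_list_sum_nth atLeast0LessThan)
  finally show ?thesis .
qed

text \<open>Each interval is replaced by its images under the two contractions, which multiplies the total
  cost by \<open>(1/4) powr s + (1/16) powr s\<close>. The exceptional fixed point 0 is covered by the degenerate
  interval \<open>{0..0}\<close>, whose cost vanishes because \<open>s > 0\<close>.\<close>

lemma gray_takagi_fix_cover:
  fixes s :: real
  assumes "0 < s"
  shows "\<exists>Is. gray_takagi_fix \<subseteq> (\<Union>(a, b)\<in>set Is. {a..b})
    \<and> (\<forall>(a, b)\<in>set Is. a \<le> b \<and> b - a \<le> (1/4) ^ n)
    \<and> (\<Sum>(a, b)\<leftarrow>Is. (b - a) powr s) = ((1/4) powr s + (1/16) powr s) ^ n"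
proof (induction n)
  case 0
  show ?case by (rule exI[of _ "[(0, 1)]"]) (auto simp: gray_takagi_fix_def)
next
  case (Suc n)
  then obtain Is where cover: "gray_takagi_fix \<subseteq> (\<Union>(a, b)\<in>set Is. {a..b})"
    and mesh: "\<And>a b. (a, b) \<in> set Is \<Longrightarrow> a \<le> b \<and> b - a \<le> (1/4) ^ n"
    and cost: "(\<Sum>(a, b)\<leftarrow>Is. (b - a) powr s) = ((1/4) powr s + (1/16) powr s) ^ n"
    by blast
  define J1 where "J1 = map (\<lambda>(a, b). (1/2 - b / 4, 1/2 - a / 4)) Is"
  define J2 where "J2 = map (\<lambda>(a, b). (1/2 + a / 16, 1/2 + b / 16)) Is"
  have c1: "(\<lambda>u. 1/2 - u / 4) ` gray_takagi_fix \<subseteq> (\<Union>(a, b)\<in>set J1. {a..b})"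
  proof safe
    fix u assume "u \<in> gray_takagi_fix"
    then obtain a b where ab: "(a, b) \<in> set Is" "u \<in> {a..b}" using cover by blast
    have "(1/2 - b / 4, 1/2 - a / 4) \<in> set J1"
      by (auto simp: J1_def intro: rev_image_eqI[OF ab(1)])
    moreover have "1/2 - u / 4 \<in> {1/2 - b / 4..1/2 - a / 4}" using ab(2) by simp
    ultimately show "1/2 - u / 4 \<in> (\<Union>(a, b)\<in>set J1. {a..b})" by blast
  qed
  have c2: "(\<lambda>u. 1/2 + u / 16) ` gray_takagi_fix \<subseteq> (\<Union>(a, b)\<in>set J2. {a..b})"
  proof safe
    fix u assume "u \<in> gray_takagi_fix"
    then obtain a b where ab: "(a, b) \<in> set Is" "u \<in> {a..b}" using cover by blast
    have "(1/2 + a / 16, 1/2 + b / 16) \<in> set J2"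
      by (auto simp: J2_def intro: rev_image_eqI[OF ab(1)])
    moreover have "1/2 + u / 16 \<in> {1/2 + a / 16..1/2 + b / 16}" using ab(2) by simp
    ultimately show "1/2 + u / 16 \<in> (\<Union>(a, b)\<in>set J2. {a..b})" by blast
  qed
  have m1: "a \<le> b \<and> b - a \<le> (1/4) ^ Suc n" if ab: "(a, b) \<in> set J1" for a b
  proof -
    obtain a' b' where *: "(a', b') \<in> set Is" "a = 1/2 - b' / 4" "b = 1/2 - a' / 4"
      using ab by (auto simp: J1_def)
    show ?thesis using mesh[OF *(1)] *(2,3) by simp
  qed
  have m2: "a \<le> b \<and> b - a \<le> (1/4) ^ Suc n" if ab: "(a, b) \<in> set J2" for a b
  proof -
    obtain a' b' where *: "(a', b') \<in> set Is" "a = 1/2 + a' / 16" "b = 1/2 + b' / 16"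
      using ab by (auto simp: J2_def)
    have "b - a \<le> (b' - a') / 4" using mesh[OF *(1)] *(2,3) by simp
    also have "\<dots> \<le> (1/4) ^ Suc n" using mesh[OF *(1)] by simp
    finally show ?thesis using mesh[OF *(1)] *(2,3) by simp
  qed
  have s1: "(\<Sum>(a, b)\<leftarrow>J1. (b - a) powr s) = (1/4) powr s * (\<Sum>(a, b)\<leftarrow>Is. (b - a) powr s)"
  proof -
    have "(1/2 - fst x / 4 - (1/2 - snd x / 4)) powr s = (1/4) powr s * (snd x - fst x) powr s" for x :: "real \<times> real"
    proof -
      have "1/2 - fst x / 4 - (1/2 - snd x / 4) = 1/4 * (snd x - fst x)" by simp
      then show ?thesis by (simp only: powr_mult)
    qed
    then show ?thesis
      by (simp only: J1_def map_map o_def case_prod_unfold fst_conv snd_conv sum_list_const_mult)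
  qed
  have s2: "(\<Sum>(a, b)\<leftarrow>J2. (b - a) powr s) = (1/16) powr s * (\<Sum>(a, b)\<leftarrow>Is. (b - a) powr s)"
  proof -
    have "(1/2 + snd x / 16 - (1/2 + fst x / 16)) powr s = (1/16) powr s * (snd x - fst x) powr s" for x :: "real \<times> real"
    proof -
      have "1/2 + snd x / 16 - (1/2 + fst x / 16) = 1/16 * (snd x - fst x)" by simp
      then show ?thesis by (simp only: powr_mult)
    qed
    then show ?thesis
      by (simp only: J2_def map_map o_def case_prod_unfold fst_conv snd_conv sum_list_const_mult)
  qed
  show ?case
  proof (intro exI[of _ "(0, 0) # J1 @ J2"] conjI)
    show "gray_takagi_fix \<subseteq> (\<Union>(a, b)\<in>set ((0, 0) # J1 @ J2). {a..b})"
    proof -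
      have "(\<Union>(a, b)\<in>set ((0, 0) # J1 @ J2). {a..b})
          = {0} \<union> (\<Union>(a, b)\<in>set J1. {a..b}) \<union> (\<Union>(a, b)\<in>set J2. {a..b})"
        by (simp add: Un_assoc)
      then show ?thesis
        by (simp only:) (intro order_trans[OF gray_takagi_fix_subset] Un_mono order_refl c1 c2)
    qed
    show "\<forall>(a, b)\<in>set ((0, 0) # J1 @ J2). a \<le> b \<and> b - a \<le> (1/4) ^ Suc n"
      using m1 m2 by auto
    show "(\<Sum>(a, b)\<leftarrow>(0, 0) # J1 @ J2. (b - a) powr s) = ((1/4) powr s + (1/16) powr s) ^ Suc n"
      using assms by (simp add: s1 s2 cost algebra_simps)
  qed
qed

text \<open>The zero set is, up to the point 0, the image of the fixed points under a contraction, so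
  the covers of the fixed points carry over without increasing cost or mesh.\<close>

lemma hausdorff_measure_level_set_zero:
  fixes s :: real
  assumes "0 < s" and q: "(1/4) powr s + (1/16) powr s < 1"
  shows "hausdorff_measure s (level_set gray_takagi 0) = 0"
proof -
  define q where "q = (1/4::real) powr s + (1/16) powr s"
  have q01: "0 \<le> q" "q < 1" using q by (auto simp: q_def)
  have "hausdorff_premeasure s \<delta> (level_set gray_takagi 0) = 0" if "0 < \<delta>" for \<delta> :: real
  proof -
    obtain N where N: "(1/4::real) ^ N < \<delta>" using real_arch_pow_inv[OF \<open>0 < \<delta>\<close>, of "1/4"] by auto
    have le: "hausdorff_premeasure s \<delta> (level_set gray_takagi 0) \<le> ennreal (q ^ n)" if "N \<le> n" for n
    proof -
      obtain Is where cover: "gray_takagi_fix \<subseteq> (\<Union>(a, b)\<in>set Is. {a..b})"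
        and mesh: "\<And>a b. (a, b) \<in> set Is \<Longrightarrow> a \<le> b \<and> b - a \<le> (1/4) ^ n"
        and cost: "(\<Sum>(a, b)\<leftarrow>Is. (b - a) powr s) = q ^ n"
        using gray_takagi_fix_cover[OF \<open>0 < s\<close>, of n] unfolding q_def by blast
      define J where "J = (0, 0) # map (\<lambda>(a, b). (1 - b / 2, 1 - a / 2)) Is"
      have "(1/4::real) ^ n \<le> (1/4) ^ N" using that by (intro power_decreasing) auto
      then have d: "(1/4::real) ^ n \<le> \<delta>" using N by linarith
      have cJ: "level_set gray_takagi 0 \<subseteq> (\<Union>(a, b)\<in>set J. {a..b})"
      proof
        fix x assume "x \<in> level_set gray_takagi 0"
        then consider "x = 0" | u where "u \<in> gray_takagi_fix" "x = 1 - u / 2"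
          using level_set_zero_subset by blast
        then show "x \<in> (\<Union>(a, b)\<in>set J. {a..b})"
        proof cases
          case 2
          then obtain a b where ab: "(a, b) \<in> set Is" "u \<in> {a..b}" using cover by blast
          have "(1 - b / 2, 1 - a / 2) \<in> set J"
            by (auto simp: J_def intro: rev_image_eqI[OF ab(1)])
          moreover have "x \<in> {1 - b / 2..1 - a / 2}" using ab(2) 2(2) by simp
          ultimately show ?thesis by blast
        qed (simp add: J_def)
      qed
      have mJ: "a \<le> b \<and> b - a \<le> \<delta>" if ab: "(a, b) \<in> set J" for a b
      proof -
        consider "a = 0" "b = 0"
          | a' b' where "(a', b') \<in> set Is" "a = 1 - b' / 2" "b = 1 - a' / 2"
          using ab by (auto simp: J_def)
        then show ?thesis
        proof cases
          case 2
          then show ?thesis using mesh[OF 2(1)] d by simp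
        qed (use \<open>0 < \<delta>\<close> in simp)
      qed
      have "hausdorff_premeasure s \<delta> (level_set gray_takagi 0) \<le> ennreal (\<Sum>(a, b)\<leftarrow>J. (b - a) powr s)"
        by (rule hausdorff_premeasure_le_intervals[OF \<open>0 < s\<close> \<open>0 < \<delta>\<close> cJ mJ])
      also have "(\<Sum>(a, b)\<leftarrow>J. (b - a) powr s) \<le> (\<Sum>(a, b)\<leftarrow>Is. (b - a) powr s)"
      proof -
        have "(\<Sum>(a, b)\<leftarrow>J. (b - a) powr s) = (\<Sum>(a, b)\<leftarrow>Is. (1 - a / 2 - (1 - b / 2)) powr s)"
          using \<open>0 < s\<close> by (simp add: J_def o_def case_prod_unfold)
        also have "\<dots> \<le> (\<Sum>(a, b)\<leftarrow>Is. (b - a) powr s)"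
        proof (rule sum_list_mono, clarify)
          fix a b assume "(a, b) \<in> set Is"
          then show "(1 - a / 2 - (1 - b / 2)) powr s \<le> (b - a) powr s"
            using mesh[of a b] \<open>0 < s\<close> by (intro powr_mono2) auto
        qed
        finally show ?thesis .
      qed
      finally show ?thesis unfolding cost by (simp add: ennreal_leI)
    qed
    have "(\<lambda>n. ennreal (q ^ n)) \<longlonglongrightarrow> ennreal 0"
      by (intro tendsto_ennrealI LIMSEQ_power_zero) (use q01 in auto)
    then have "hausdorff_premeasure s \<delta> (level_set gray_takagi 0) \<le> ennreal 0"
      by (rule LIMSEQ_le_const) (use le in auto)
    then show ?thesis by simp
  qed
  then show ?thesis unfolding hausdorff_measure_def by simp
qed

section \<open>Lower bound\<close>

context
  fixes p :: real
  assumes p01: "0 < p" "p < 1" and psum: "p + p\<^sup>2 = 1"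
begin

text \<open>The interval \<open>[0, 1]\<close> is split at \<open>p\<close>: the identity \<open>p + p\<^sup>2 = 1\<close> makes the upper piece have length
  \<open>p\<^sup>2\<close>. The function \<open>rescale\<close> stretches either piece back to \<open>[0, 1]\<close>, and \<open>branch\<close> selects the
  contraction that belongs to the piece.\<close>

definition rescale :: "real \<Rightarrow> real" where
  "rescale t = (if t < p then t / p else (t - p) / p\<^sup>2)"

definition branch :: "real \<Rightarrow> real \<Rightarrow> real" where
  "branch t u = (if t < p then 1/2 - u / 4 else 1/2 + u / 16)"

lemma rescale_unit: "t \<in> {0..1} \<Longrightarrow> rescale t \<in> {0..1}"
proof -
  assume t: "t \<in> {0..1}"
  then have "t - p \<le> p\<^sup>2" using psum by simp
  then show ?thesis using t p01 by (auto simp: rescale_def divide_le_eq_1)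
qed

lemma branch_range: "u \<in> {1/4..1} \<Longrightarrow> branch t u \<in> {1/4..1}"
  by (auto simp: branch_def)

lemma branch_contract: "\<bar>branch t u - branch t v\<bar> \<le> \<bar>u - v\<bar> / 4"
  by (auto simp: branch_def abs_if field_simps)

text \<open>The first \<open>n\<close> symbols of the address of \<open>t\<close>, applied to a common base point. The interval
  \<open>[1/4, 1]\<close> contains the base point and is mapped into itself by both contractions. It excludes
  the fixed point 0, whose two images coincide, so that its own images are disjoint.\<close>

primrec coding_approx :: "nat \<Rightarrow> real \<Rightarrow> real" where
  "coding_approx 0 t = 1"
| "coding_approx (Suc n) t = branch t (coding_approx n (rescale t))"

lemma coding_approx_range: "coding_approx n t \<in> {1/4..1}"
proof (induction n arbitrary: t)
  case (Suc n)
  then show ?case using branch_range by simp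
qed simp

lemma coding_approx_step: "\<bar>coding_approx (Suc n) t - coding_approx n t\<bar> \<le> (1/4) ^ n"
proof (induction n arbitrary: t)
  case 0
  then show ?case using coding_approx_range[of 1 t] by simp
next
  case (Suc n)
  have "\<bar>coding_approx (Suc (Suc n)) t - coding_approx (Suc n) t\<bar>
      \<le> \<bar>coding_approx (Suc n) (rescale t) - coding_approx n (rescale t)\<bar> / 4"
    using branch_contract by (simp only: coding_approx.simps)
  also have "\<dots> \<le> (1/4) ^ Suc n" using Suc[of "rescale t"] by simp
  finally show ?case .
qed

definition coding :: "real \<Rightarrow> real" where
  "coding t = lim (\<lambda>n. coding_approx n t)"

lemma coding_approx_LIMSEQ: "(\<lambda>n. coding_approx n t) \<longlonglongrightarrow> coding t"
proof -
  have "summable (\<lambda>n. coding_approx (Suc n) t - coding_approx n t)"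
    by (rule summable_comparison_test[where g = "\<lambda>n. (1/4) ^ n"])
       (use coding_approx_step in \<open>auto simp del: coding_approx.simps intro!: summable_geometric\<close>)
  then have "convergent (\<lambda>m. \<Sum>n<m. coding_approx (Suc n) t - coding_approx n t)"
    by (simp add: summable_iff_convergent)
  then have "convergent (\<lambda>m. coding_approx m t - 1)"
    using sum_lessThan_telescope[of "\<lambda>n. coding_approx n t"] by (simp del: coding_approx.simps(2))
  then have "convergent (\<lambda>m. coding_approx m t)"
    using convergent_diff_const_right_iff by blast
  then show ?thesis unfolding coding_def by (simp add: convergent_LIMSEQ_iff)
qed

lemma coding_rec: "coding t = branch t (coding (rescale t))"
proof (rule LIMSEQ_unique)
  show "(\<lambda>n. coding_approx (Suc n) t) \<longlonglongrightarrow> coding t"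
    using coding_approx_LIMSEQ by (rule LIMSEQ_Suc)
  show "(\<lambda>n. coding_approx (Suc n) t) \<longlonglongrightarrow> branch t (coding (rescale t))"
    by (auto simp: branch_def intro!: tendsto_intros coding_approx_LIMSEQ)
qed

lemma coding_range: "coding t \<in> {1/4..1}"
  using coding_approx_LIMSEQ by (rule closed_sequentially[rotated 2])
    (use coding_approx_range in auto)

text \<open>Unfolding the recursion \<open>n\<close> times shows that the defect at \<open>coding t\<close> is at most \<open>(1/4) ^ n\<close>
  times the defect at another point, which is bounded.\<close>

lemma coding_in_fix: "coding t \<in> gray_takagi_fix"
proof -
  have le: "\<bar>gray_takagi (coding t) - coding t\<bar> \<le> 2 * (1/4) ^ n" for n t
  proof (induction n arbitrary: t)
    case 0
    show ?case using abs_gray_takagi_le[of "coding t"] coding_range[of t]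
      by (simp add: abs_if split: if_splits)
  next
    case (Suc n)
    let ?u = "coding (rescale t)"
    have u: "0 \<le> ?u" "?u \<le> 1" using coding_range[of "rescale t"] by auto
    have "\<bar>gray_takagi (branch t ?u) - branch t ?u\<bar> \<le> \<bar>gray_takagi ?u - ?u\<bar> / 4"
      proof (cases "t < p")
      case True
      then have "branch t ?u = 1/2 - ?u / 4" by (simp add: branch_def)
      then show ?thesis by (simp add: fixed_point_defect_quarter[OF u] abs_divide del: minus_diff_eq)
    next
      case False
      then have "branch t ?u = 1/2 + ?u / 16" by (simp add: branch_def)
      then show ?thesis by (simp add: fixed_point_defect_sixteenth[OF u] abs_divide)
    qed
    then show ?case using Suc[of "rescale t"] coding_rec[of t] by simp
  qed
  have "(\<lambda>n. 2 * (1/4::real) ^ n) \<longlonglongrightarrow> 2 * 0"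
    by (intro tendsto_mult tendsto_const LIMSEQ_power_zero) simp
  then have "\<bar>gray_takagi (coding t) - coding t\<bar> \<le> 2 * 0"
    by (rule LIMSEQ_le_const) (use le in auto)
  then show ?thesis using coding_range[of t] by (simp add: gray_takagi_fix_def)
qed

text \<open>The contractions map \<open>[1/4, 1]\<close> into \<open>[1/4, 7/16]\<close> and \<open>[33/64, 9/16]\<close>.\<close>

lemma coding_gap:
  assumes "t < p" "p \<le> t'"
  shows "5/64 \<le> \<bar>coding t - coding t'\<bar>"
  using assms coding_rec[of t] coding_rec[of t']
    coding_range[of "rescale t"] coding_range[of "rescale t'"]
  by (simp add: branch_def)

text \<open>As long as \<open>t\<close> and \<open>t'\<close> lie in the same piece, rescaling multiplies both sides by the same
  factor, since the ratios 1/4 and 1/16 raised to the power \<open>d\<close> are \<open>p\<close> and \<open>p\<^sup>2\<close>. Rescaling also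
  stretches the distance of \<open>t\<close> and \<open>t'\<close> by at least \<open>1 / p\<close>, so that distinct points are
  separated after finitely many steps. Then the gap gives the inequality: the left
  side is at most 1 and the right side at least 1.\<close>

lemma coding_expanding:
  assumes d: "0 \<le> d" "(1/4) powr d = p" and t: "t \<in> {0..1}" "t' \<in> {0..1}"
  shows "\<bar>t - t'\<bar> \<le> (64/5) powr d * \<bar>coding t - coding t'\<bar> powr d"
proof -
  have d16: "(1/16::real) powr d = p\<^sup>2"
    using powr_mult[of "1/4" "1/4" d] d(2) by (simp add: power2_eq_square)
  \<comment> \<open>The induction is on a bound \<open>n\<close> for the number of steps until separation.\<close>
  have main: "\<bar>t - t'\<bar> \<le> (64/5) powr d * \<bar>coding t - coding t'\<bar> powr d"
    if "p ^ n < \<bar>t - t'\<bar>" "t \<in> {0..1}" "t' \<in> {0..1}" for n t t'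
    using that
  proof (induction n arbitrary: t t')
    case 0
    then show ?case by auto
  next
    case (Suc n)
    let ?u = "rescale t" and ?u' = "rescale t'"
    have uu: "?u \<in> {0..1}" "?u' \<in> {0..1}" using Suc.prems rescale_unit by auto
    consider (low) "t < p" "t' < p" | (high) "p \<le> t" "p \<le> t'"
      | (split) "t < p \<and> p \<le> t' \<or> t' < p \<and> p \<le> t" by linarith
    then show ?case
    proof cases
      case low
      have e: "\<bar>t - t'\<bar> = p * \<bar>?u - ?u'\<bar>"
        using low p01 by (simp add: rescale_def diff_divide_distrib[symmetric] abs_divide)
      have "\<bar>coding t - coding t'\<bar> = 1/4 * \<bar>coding ?u - coding ?u'\<bar>"
        using low coding_rec[of t] coding_rec[of t'] by (simp add: branch_def abs_if)
      then have c: "\<bar>coding t - coding t'\<bar> powr d = p * \<bar>coding ?u - coding ?u'\<bar> powr d"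
        using d(2) by (simp only: powr_mult)
      have "p * p ^ n < p * \<bar>?u - ?u'\<bar>" using Suc.prems(1) e by simp
      then have "p ^ n < \<bar>?u - ?u'\<bar>" using p01 by simp
      from Suc.IH[OF this uu]
      have "p * \<bar>?u - ?u'\<bar> \<le> p * ((64/5) powr d * \<bar>coding ?u - coding ?u'\<bar> powr d)"
        using p01 by (intro mult_left_mono) auto
      then show ?thesis unfolding e c by (simp add: mult.left_commute)
    next
      case high
      have e: "\<bar>t - t'\<bar> = p\<^sup>2 * \<bar>?u - ?u'\<bar>"
        using high p01 by (simp add: rescale_def diff_divide_distrib[symmetric] abs_divide)
      have "\<bar>coding t - coding t'\<bar> = 1/16 * \<bar>coding ?u - coding ?u'\<bar>"
        using high coding_rec[of t] coding_rec[of t'] by (simp add: branch_def abs_if)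
      then have c: "\<bar>coding t - coding t'\<bar> powr d = p\<^sup>2 * \<bar>coding ?u - coding ?u'\<bar> powr d"
        using d16 by (simp only: powr_mult)
      have "p\<^sup>2 * p ^ n \<le> p * p ^ n"
        using p01 by (intro mult_right_mono) (auto simp: power2_eq_square mult_left_le)
      then have "p\<^sup>2 * p ^ n < p\<^sup>2 * \<bar>?u - ?u'\<bar>" using Suc.prems(1) e by simp
      then have "p ^ n < \<bar>?u - ?u'\<bar>" using p01 by simp
      from Suc.IH[OF this uu]
      have "p\<^sup>2 * \<bar>?u - ?u'\<bar> \<le> p\<^sup>2 * ((64/5) powr d * \<bar>coding ?u - coding ?u'\<bar> powr d)"
        by (intro mult_left_mono) auto
      then show ?thesis unfolding e c by (simp add: mult.left_commute)
    next
      case split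
      then have "5/64 \<le> \<bar>coding t - coding t'\<bar>"
        using coding_gap[of t t'] coding_gap[of t' t] by (auto simp: abs_minus_commute)
      then have "1 \<le> (64/5 * \<bar>coding t - coding t'\<bar>) powr d"
        using d(1) by (intro ge_one_powr_ge_zero) auto
      then have "1 \<le> (64/5) powr d * \<bar>coding t - coding t'\<bar> powr d" by (simp only: powr_mult)
      then show ?thesis using Suc.prems(2,3) by (simp, linarith)
    qed
  qed
  show ?thesis
  proof (cases "t = t'")
    case False
    then obtain n where "p ^ n < \<bar>t - t'\<bar>" using real_arch_pow_inv[of "\<bar>t - t'\<bar>" p] p01 by auto
    then show ?thesis using main t by blast
  qed simp
qed

end

text \<open>This is the mass distribution principle for the image of Lebesgue measure under \<open>G\<close>. The
  preimage of a set of diameter \<open>\<delta>\<close> need not be measurable, but it lies in an interval of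
  length \<open>2 * C * \<delta> powr d\<close>. Only covers of mesh at most 1 are considered, so that
  decreasing the exponent from \<open>d\<close> to \<open>s\<close> can only increase the cost.\<close>

lemma hausdorff_measure_pos_if_expanding:
  fixes G :: "real \<Rightarrow> 'a::metric_space"
  assumes G: "\<And>t. t \<in> {0..1} \<Longrightarrow> G t \<in> A"
    and expand: "\<And>t t'. t \<in> {0..1} \<Longrightarrow> t' \<in> {0..1} \<Longrightarrow> \<bar>t - t'\<bar> \<le> C * dist (G t) (G t') powr d"
    and "0 < C" "0 < d" "0 \<le> s" "s \<le> d"
  shows "hausdorff_measure s A \<noteq> 0"
proof -
  have bound: "ennreal (1 / (2 * C)) \<le> (\<Sum>i. ennreal (diam_pow s (U i)))"
    if cover: "A \<subseteq> (\<Union>i. U i)" and bd: "\<And>i. bounded (U i)" and le1: "\<And>i. diameter (U i) \<le> 1"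
    for U :: "nat \<Rightarrow> 'a set"
  proof -
    define T where "T i = {t \<in> {0..1}. G t \<in> U i}" for i
    have "\<exists>I. T i \<subseteq> I \<and> I \<in> sets lborel \<and> emeasure lborel I \<le> ennreal (2 * C) * ennreal (diam_pow s (U i))" for i
    proof (cases "T i = {}")
      case True
      then show ?thesis by (intro exI[of _ "{}"]) auto
    next
      case False
      then obtain t0 where t0: "t0 \<in> {0..1}" "G t0 \<in> U i" by (auto simp: T_def)
      define r where "r = C * diameter (U i) powr d"
      have dn: "0 \<le> diameter (U i)" using bd by (rule diameter_ge_0)
      have "diameter (U i) powr d \<le> diam_pow s (U i)"
      proof (cases "s = 0")
        case True
        then show ?thesis using t0 le1[of i] dn \<open>0 < d\<close> by (auto simp: diam_pow_def intro!: powr_le1)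
      next
        case False
        then show ?thesis
          using t0 le1[of i] dn assms(5,6) by (auto simp: diam_pow_def intro!: powr_mono')
      qed
      then have r: "0 \<le> r" "2 * r \<le> 2 * C * diam_pow s (U i)"
        using \<open>0 < C\<close> by (auto simp: r_def)
      have "T i \<subseteq> {t0 - r..t0 + r}"
      proof
        fix t assume "t \<in> T i"
        then have t: "t \<in> {0..1}" "G t \<in> U i" by (auto simp: T_def)
        have "\<bar>t - t0\<bar> \<le> C * dist (G t) (G t0) powr d" by (rule expand[OF t(1) t0(1)])
        also have "\<dots> \<le> r" unfolding r_def
          using \<open>0 < C\<close> \<open>0 < d\<close> diameter_bounded_bound[OF bd t(2) t0(2)]
          by (intro mult_left_mono powr_mono2) auto
        finally show "t \<in> {t0 - r..t0 + r}" by auto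
      qed
      moreover have "emeasure lborel {t0 - r..t0 + r} \<le> ennreal (2 * C) * ennreal (diam_pow s (U i))"
        using r \<open>0 < C\<close> by (simp add: ennreal_mult'[symmetric] ennreal_leI)
      ultimately show ?thesis by (intro exI[of _ "{t0 - r..t0 + r}"]) auto
    qed
    then obtain I where I: "\<And>i. T i \<subseteq> I i" "\<And>i. I i \<in> sets lborel"
        "\<And>i. emeasure lborel (I i) \<le> ennreal (2 * C) * ennreal (diam_pow s (U i))"
      by metis
    have "{0..1} \<subseteq> (\<Union>i. T i)" using G cover by (fastforce simp: T_def)
    then have sub: "{0..1} \<subseteq> (\<Union>i. I i)" using I(1) by blast
    have "1 = emeasure lborel {0..1::real}" by simp
    also have "\<dots> \<le> emeasure lborel (\<Union>i. I i)" using sub I(2) by (intro emeasure_mono) auto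
    also have "\<dots> \<le> (\<Sum>i. emeasure lborel (I i))"
      using I(2) by (intro emeasure_subadditive_countably) auto
    also have "\<dots> \<le> (\<Sum>i. ennreal (2 * C) * ennreal (diam_pow s (U i)))"
      using I(3) by (intro suminf_le) auto
    also have "\<dots> = ennreal (2 * C) * (\<Sum>i. ennreal (diam_pow s (U i)))" by simp
    finally have "ennreal (1 / (2 * C)) * 1
        \<le> ennreal (1 / (2 * C)) * (ennreal (2 * C) * (\<Sum>i. ennreal (diam_pow s (U i))))"
      by (rule mult_left_mono) simp
    also have "\<dots> = (\<Sum>i. ennreal (diam_pow s (U i)))"
      using \<open>0 < C\<close> by (simp add: mult.assoc[symmetric] ennreal_mult[symmetric])
    finally show ?thesis by simp
  qed
  have "ennreal (1 / (2 * C)) \<le> hausdorff_premeasure s 1 A"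
    unfolding hausdorff_premeasure_def by (rule Inf_greatest) (use bound in auto)
  also have "\<dots> \<le> hausdorff_measure s A"
    unfolding hausdorff_measure_def by (rule SUP_upper) auto
  finally show ?thesis using \<open>0 < C\<close> by auto
qed

section \<open>The dimension\<close>

theorem proposition1p7:
  "hausdorff_dim (level_set gray_takagi 0) = ereal (ln ((1 + sqrt 5) / 2) / ln 4)"
proof -
  define \<phi> :: real where "\<phi> = (1 + sqrt 5) / 2"
  define d where "d = ln \<phi> / ln 4"
  define p where "p = 1 / \<phi>"
  have "1 < sqrt (5::real)" by simp
  then have phi: "1 < \<phi>" unfolding \<phi>_def by simp
  have phi2: "\<phi>\<^sup>2 = \<phi> + 1"
    by (simp add: \<phi>_def power2_eq_square field_simps)
  have p01: "0 < p" "p < 1" using phi by (auto simp: p_def)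
  have psum: "p + p\<^sup>2 = 1" using phi phi2 by (simp add: p_def field_simps power2_eq_square)
  have d0: "0 < d" using phi by (simp add: d_def)
  have "(4::real) powr d = \<phi>" using phi by (simp add: d_def powr_def)
  then have pd: "(1/4::real) powr d = p" by (simp add: p_def powr_divide)
  have upper: "hausdorff_measure s (level_set gray_takagi 0) = 0" if "d < s" for s
  proof (rule hausdorff_measure_level_set_zero)
    show "0 < s" using d0 that by simp
    have lt: "(1/4::real) powr s < p" unfolding pd[symmetric] using that by (intro powr_less_mono') auto
    have "(1/16::real) powr s = ((1/4) powr s)\<^sup>2"
      using powr_mult[of "1/4" "1/4" s] by (simp add: power2_eq_square)
    also have "\<dots> < p\<^sup>2" using lt by (intro power_strict_mono) auto
    finally show "(1/4) powr s + (1/16) powr s < 1" using lt psum by simp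
  qed
  \<comment> \<open>The map \<open>u \<mapsto> 1 - u / 2\<close> from fixed points to zeros halves distances, which doubles the base
    64/5 of the constant.\<close>
  have lower: "hausdorff_measure s (level_set gray_takagi 0) \<noteq> 0" if "0 \<le> s" "s \<le> d" for s
  proof (rule hausdorff_measure_pos_if_expanding[where G = "\<lambda>t. 1 - coding p t / 2" and d = d
        and C = "(128/5) powr d"])
    fix t :: real
    show "1 - coding p t / 2 \<in> level_set gray_takagi 0"
      using coding_in_fix[OF p01 psum, of t] zero_iff_fixed[of "coding p t"]
      by (auto simp: level_set_def gray_takagi_fix_def)
  next
    fix t t' :: real assume t: "t \<in> {0..1}" "t' \<in> {0..1}"
    have "dist (1 - coding p t / 2) (1 - coding p t' / 2) = 1/2 * \<bar>coding p t - coding p t'\<bar>"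
      by (simp add: dist_real_def abs_minus_commute diff_divide_distrib[symmetric])
    then have "dist (1 - coding p t / 2) (1 - coding p t' / 2) powr d
        = (1/2) powr d * \<bar>coding p t - coding p t'\<bar> powr d"
      by (simp only: powr_mult)
    moreover have "(128/5::real) powr d * (1/2) powr d = (64/5) powr d"
      by (simp add: powr_mult[symmetric])
    ultimately have "(128/5) powr d * dist (1 - coding p t / 2) (1 - coding p t' / 2) powr d
        = (64/5) powr d * \<bar>coding p t - coding p t'\<bar> powr d"
      by (simp only: mult.assoc[symmetric])
    then show "\<bar>t - t'\<bar> \<le> (128/5) powr d * dist (1 - coding p t / 2) (1 - coding p t' / 2) powr d"
      using coding_expanding[OF p01 psum _ pd t] d0 by simp
  qed (use d0 that in auto)
  have "hausdorff_dim (level_set gray_takagi 0) = ereal d"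
    unfolding hausdorff_dim_def
  proof (rule antisym)
    show "Inf {ereal s |s. 0 \<le> s \<and> hausdorff_measure s (level_set gray_takagi 0) = 0} \<le> ereal d"
    proof (rule ereal_le_epsilon2)
      fix e :: real assume "0 < e"
      then show "Inf {ereal s |s. 0 \<le> s \<and> hausdorff_measure s (level_set gray_takagi 0) = 0} \<le> ereal d + ereal e"
        using upper[of "d + e"] d0 by (intro Inf_lower) auto
    qed
    show "ereal d \<le> Inf {ereal s |s. 0 \<le> s \<and> hausdorff_measure s (level_set gray_takagi 0) = 0}"
      by (rule Inf_greatest) (use lower in force)
  qed
  then show ?thesis unfolding d_def \<phi>_def .
qed

end
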